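(* For every positive integer $n$ and every $u$, the Bernoulli polynomial $B_n(u)$ satisfies \begin{multline*} B_n(u)=\sum_{k=1}^n k! \sum_{r+s=k}\sum_{\ell+m=n}(-1)^m\binom{n}{\ell} \frac{\ell!}{(\ell+r)!}\frac{m!}{(m+s)!}\Biggl[\sum_{i=0}^r\sum_{j=0}^s(-1)^{i+j}\\ \times\binom{\ell+r}{r-i}\binom{m+s}{s-j}S(\ell+i,i)\,S(m+j,j)\Biggr]u^{m+s}(1-u)^{\ell+r}, \end{multline*} where the sums over $r+s=k$ and $\ell+m=n$ run over nonnegative integers $r,s$ and $\ell,m$. Consequently, for every positive integer $n$, the Bernoulli number $B_n$ is \[ B_n=\sum_{i=1}^n(-1)^{i}\frac{\binom{n+1}{i+1}}{\binom{n+i}{i}}\, S(n+i,i). \]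
   Context: The Bernoulli polynomials $B_k(u)$ are defined by $\frac{ze^{uz}}{e^z-1}=\sum_{k=0}^\infty B_k(u)\frac{z^k}{k!}$ for $|z|<2\pi$. The Bernoulli numbers are $B_k=B_k(0)$. $S(p,q)$ denotes the Stirling numbers of the second kind. For $p\ge q\ge1$ they are given by $S(p,q)=\frac{1}{q!}\sum_{\ell=1}^q(-1)^{q-\ell}\binom{q}{\ell}\ell^{p}$. We use the standard conventions $S(0,0)=1$ and $S(p,0)=0$ for $p\ge1$, together with $0^0=1$. *)

theory Defs
  imports
    "HOL-Complex_Analysis.Complex_Analysis"
    "HOL-Combinatorics.Stirling"
begin

text \<open>
  The coefficient sequence is characterised on the punctured disc, since the quotient
  has only a removable singularity at the origin (where HOL evaluates it to \<open>0\<close>, not \<open>1\<close>).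
  Existence and uniqueness of the sequence are established below.
\<close>

definition bernoulli_poly :: "nat \<Rightarrow> complex \<Rightarrow> complex" where
  "bernoulli_poly k u =
     (THE B :: nat \<Rightarrow> complex. \<forall>z. z \<noteq> 0 \<and> norm z < 2 * pi \<longrightarrow>
        (\<lambda>j. B j * (z ^ j / fact j)) sums (z * exp (u * z) / (exp z - 1))) k"

definition bernoulli_number :: "nat \<Rightarrow> complex" where
  "bernoulli_number k = bernoulli_poly k 0"

lemma bernoulli_gen_exists:
  fixes u :: complex
  shows "\<exists>B :: nat \<Rightarrow> complex. \<forall>z. z \<noteq> 0 \<and> norm z < 2 * pi \<longrightarrow>
           (\<lambda>j. B j * (z ^ j / fact j)) sums (z * exp (u * z) / (exp z - 1))"
proof -
  define g :: "complex \<Rightarrow> complex" where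
    "g = (\<lambda>z. if z = 0 then deriv exp 0 else (exp z - exp 0) / (z - 0))"
  have g: "g holomorphic_on ball 0 (2 * pi)"
    unfolding g_def by (rule pole_lemma) (auto intro!: holomorphic_intros)
  have nz: "g z \<noteq> 0" if "z \<in> ball 0 (2 * pi)" for z
  proof (cases "z = 0")
    case True
    then show ?thesis
      using DERIV_imp_deriv[OF DERIV_exp[of "0 :: complex"]] by (simp add: g_def)
  next
    case False
    have "exp z \<noteq> 1"
    proof
      assume "exp z = 1"
      then obtain n :: int where n: "Re z = 0" "Im z = of_int (2 * n) * pi"
        by (auto simp: exp_eq_1)
      then have "norm z = 2 * pi * \<bar>of_int n\<bar>"
        by (simp add: cmod_eq_Im abs_mult)
      with that have "\<bar>real_of_int n\<bar> < 1"
        by simp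
      then have "n = 0" by linarith
      with n False show False by (simp add: complex_eq_iff)
    qed
    with False show ?thesis by (simp add: g_def)
  qed
  define f where "f = (\<lambda>z. exp (u * z) / g z)"
  have f: "f holomorphic_on ball 0 (2 * pi)"
    unfolding f_def using nz by (intro holomorphic_intros g) auto
  have "(\<lambda>j. (deriv ^^ j) f 0 * (z ^ j / fact j)) sums (z * exp (u * z) / (exp z - 1))"
    if "z \<noteq> 0" "norm z < 2 * pi" for z
    using holomorphic_power_series[OF f, of z] that by (simp add: f_def g_def mult.commute)
  then show ?thesis
    by (intro exI[of _ "\<lambda>j. (deriv ^^ j) f 0"]) simp
qed

lemma bernoulli_gen_unique:
  fixes A B :: "nat \<Rightarrow> complex"
  assumes A: "\<And>z. z \<noteq> 0 \<Longrightarrow> norm z < 2 * pi \<Longrightarrow> (\<lambda>j. A j * (z ^ j / fact j)) sums h z"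
      and B: "\<And>z. z \<noteq> 0 \<Longrightarrow> norm z < 2 * pi \<Longrightarrow> (\<lambda>j. B j * (z ^ j / fact j)) sums h z"
  shows "A = B"
proof -
  define c where "c = (\<lambda>j. (A j - B j) / fact j)"
  have c: "(\<lambda>j. c j * z ^ j) sums 0" if "z \<noteq> 0" "norm z < 2 * pi" for z
    using sums_diff[OF A[OF that] B[OF that]] by (simp add: c_def diff_divide_distrib algebra_simps)
  have "((\<lambda>_. 0) \<longlongrightarrow> c 0) (at (0 :: complex))"
    by (rule powser_limit_0_strong[of "2 * pi"]) (use c in auto)
  then have c0: "c 0 = 0"
    using tendsto_unique[OF trivial_limit_at _ tendsto_const] by blast
  have sm: "(\<lambda>j. c j * (z - 0) ^ j) sums 0" if "norm (z - 0) < 2 * pi" for z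
    using c[of z] c0 that by (cases "z = 0") auto
  have "c m = 0" for m
  proof (rule ccontr)
    assume m: "c m \<noteq> 0"
    with c0 have "m > 0" by (cases m) auto
    obtain s :: real where s: "0 < s"
      "\<And>z :: complex. z \<in> cball 0 s - {0} \<Longrightarrow> (0 :: complex) \<noteq> 0"
      using powser_0_nonzero[of "2 * pi" 0 c "\<lambda>_. 0" m] sm m \<open>m > 0\<close> by auto
    then show False using s(2)[of "of_real s"] by auto
  qed
  then show ?thesis by (auto simp: c_def fun_eq_iff)
qed

lemma bernoulli_poly_sums:
  assumes "z \<noteq> 0" "norm z < 2 * pi"
  shows "(\<lambda>k. bernoulli_poly k u * (z ^ k / fact k)) sums (z * exp (u * z) / (exp z - 1))"
proof -
  have "\<exists>!B :: nat \<Rightarrow> complex. \<forall>z. z \<noteq> 0 \<and> norm z < 2 * pi \<longrightarrow>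
          (\<lambda>j. B j * (z ^ j / fact j)) sums (z * exp (u * z) / (exp z - 1))"
  proof (rule ex_ex1I)
    show "A = B" if
      "\<forall>z. z \<noteq> 0 \<and> norm z < 2 * pi \<longrightarrow>
         (\<lambda>j. A j * (z ^ j / fact j)) sums (z * exp (u * z) / (exp z - 1))"
      "\<forall>z. z \<noteq> 0 \<and> norm z < 2 * pi \<longrightarrow>
         (\<lambda>j. B j * (z ^ j / fact j)) sums (z * exp (u * z) / (exp z - 1))"
      for A B :: "nat \<Rightarrow> complex"
      by (rule bernoulli_gen_unique[where h = "\<lambda>z. z * exp (u * z) / (exp z - 1)"])
         (use that in simp_all)
  qed (rule bernoulli_gen_exists)
  from theI'[OF this] assms show ?thesis
    unfolding bernoulli_poly_def by blast
qed

lemma Stirling_explicit: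
  "(of_nat (Stirling p q) :: 'a :: field_char_0) =
     (\<Sum>l\<le>q. (-1) ^ (q - l) * of_nat (q choose l) * of_nat l ^ p) / fact q"
proof (induction p q rule: Stirling.induct)
  case 1
  show ?case by simp
next
  case (2 k)
  have "(\<Sum>l\<le>Suc k. of_nat (Suc k choose l) * 1 ^ l * (-1) ^ (Suc k - l)) = (1 + (-1) :: 'a) ^ Suc k"
    by (rule binomial_ring[symmetric])
  then show ?case by (simp add: mult.commute del: sum.atMost_Suc)
next
  case (3 n)
  show ?case by simp
next
  case (4 n k)
  let ?t = "\<lambda>q p l. (-1) ^ (q - l) * of_nat (q choose l) * of_nat l ^ p :: 'a"
  have step: "?t (Suc k) (Suc n) l = of_nat (Suc k) * (?t (Suc k) n l + (if l \<le> k then ?t k n l else 0))"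
    if "l \<le> Suc k" for l
  proof (cases "l = Suc k")
    case True
    then show ?thesis by simp
  next
    case False
    with that have l: "l \<le> k" by simp
    then have "(Suc k - l) * (Suc k choose l) = Suc k * (k choose l)"
      by (metis Suc_diff_le binomial_absorb_comp binomial_absorption diff_Suc_1 le_Suc_eq)
    then have "of_nat (Suc k - l) * of_nat (Suc k choose l) = (of_nat (Suc k) * of_nat (k choose l) :: 'a)"
      by (metis of_nat_mult)
    then have e: "(of_nat (Suc k) - of_nat l) * of_nat (Suc k choose l)
                = (of_nat (Suc k) * of_nat (k choose l) :: 'a)"
      using that by (simp add: of_nat_diff)
    have "of_nat (Suc k) * (?t (Suc k) n l + ?t k n l) - ?t (Suc k) (Suc n) l
        = (-1) ^ (k - l) * of_nat l ^ n *
          (of_nat (Suc k) * of_nat (k choose l) - (of_nat (Suc k) - of_nat l) * of_nat (Suc k choose l))"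
      using l by (simp only: Suc_diff_le power_Suc) (simp only: algebra_simps, simp add: algebra_simps)
    with e l show ?thesis by simp
  qed
  have "(\<Sum>l\<le>Suc k. ?t (Suc k) (Suc n) l)
      = of_nat (Suc k) * ((\<Sum>l\<le>Suc k. ?t (Suc k) n l) + (\<Sum>l\<le>k. ?t k n l))"
  proof -
    have "(\<Sum>l\<le>Suc k. if l \<le> k then ?t k n l else 0) = (\<Sum>l\<le>k. ?t k n l)"
      by (simp add: sum.If_cases)
    then show ?thesis
      using step by (simp add: sum_distrib_left[symmetric] sum.distrib del: sum.atMost_Suc of_nat_Suc)
  qed
  then have "(\<Sum>l\<le>Suc k. ?t (Suc k) (Suc n) l) / fact (Suc k)
      = of_nat (Suc k) * ((\<Sum>l\<le>Suc k. ?t (Suc k) n l) / fact (Suc k)) + (\<Sum>l\<le>k. ?t k n l) / fact k"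
    by (simp add: field_simps del: sum.atMost_Suc of_nat_Suc)
  then show ?case
    unfolding Stirling.simps of_nat_add of_nat_mult "4.IH" by (rule sym)
qed

end

theory Submission
  imports Defs
begin

text \<open>
  Put $E(z) = (e^z - 1)/z$ and $G(z) = (e^{(1-u)z} - e^{-uz})/z = (1-u)\,E((1-u)z) + u\,E(-uz)$.
  The generating function of the Bernoulli polynomials is $1/G$, and $G(0) = 1$, so
  $B_n(u)/n!$ is the coefficient of $z^n$ in $\sum_{k \le n} (1-G)^k$.  Since
  $1 - G = (1-u)(1 - E((1-u)z)) + u(1 - E(-uz))$, two binomial expansions reduce everything to
  the coefficients of $E^i$, which are Stirling numbers because $(e^z - 1)^i/i!$ is
  their exponential generating function.  For $u = 0$ one has $G = E$, and the sum over $k$ is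
  evaluated by the hockey-stick identity.
\<close>

unbundle no vec_syntax

section \<open>Stirling numbers as coefficients of powers of
  \<open>E(z) = (e^z - 1)/z\<close>\<close>

text \<open>The binomial theorem turns the power into a combination of exponentials
  \<open>e^(lz)\<close>, whose coefficients \<open>l^p/p!\<close> reproduce the alternating sum for
  the Stirling numbers.\<close>

lemma fps_exp_minus_one_power_nth:
  "((fps_exp 1 - 1 :: 'a :: field_char_0 fps) ^ q) $ p = fact q * of_nat (Stirling p q) / fact p"
proof -
  have "(fps_exp 1 - 1 :: 'a fps) ^ q =
      (\<Sum>l\<le>q. fps_const (of_nat (q choose l) * (-1) ^ (q - l)) * fps_exp (of_nat l))"
    using binomial_ring[of "fps_exp 1 :: 'a fps" "-1" q]
    by (simp add: fps_exp_power_mult fps_of_nat fps_const_neg[symmetric] fps_const_power[symmetric]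
        fps_const_mult[symmetric] mult_ac del: fps_const_mult fps_const_power fps_const_neg)
  then show ?thesis
    by (simp add: fps_sum_nth Stirling_explicit sum_distrib_left sum_divide_distrib mult_ac)
qed

text \<open>The series \<open>E\<close> of the introduction; the shift is an exact division by z, as
  \<open>e^z - 1\<close> has constant term 0.\<close>

definition expm1_quot :: "'a :: field_char_0 fps" where
  "expm1_quot = fps_shift 1 (fps_exp 1 - 1)"

lemma X_mult_expm1_quot: "fps_X * expm1_quot = fps_exp 1 - (1 :: 'a :: field_char_0 fps)"
  by (rule fps_ext) (auto simp: expm1_quot_def)

lemma expm1_quot_power_nth:
  "(expm1_quot ^ i :: 'a :: field_char_0 fps) $ l = fact i * of_nat (Stirling (l + i) i) / fact (l + i)"
proof -
  have "(expm1_quot ^ i :: 'a fps) $ l = (fps_X ^ i * expm1_quot ^ i) $ (l + i)"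
    by (simp add: fps_X_power_mult_nth)
  also have "fps_X ^ i * expm1_quot ^ i = (fps_exp 1 - 1 :: 'a fps) ^ i"
    by (simp add: X_mult_expm1_quot flip: power_mult_distrib)
  finally show ?thesis
    by (simp add: fps_exp_minus_one_power_nth)
qed

lemma one_minus_expm1_quot_power:
  "(1 - expm1_quot :: 'a :: field_char_0 fps) ^ r =
     (\<Sum>i=0..r. fps_const ((-1) ^ i * of_nat (r choose i)) * expm1_quot ^ i)"
  using binomial_ring[of "- expm1_quot :: 'a fps" 1 r]
  by (simp add: power_minus[of expm1_quot] fps_of_nat fps_const_neg[symmetric] fps_const_power[symmetric]
      fps_const_mult[symmetric] mult_ac atLeast0AtMost del: fps_const_mult fps_const_power fps_const_neg)

lemma one_minus_expm1_quot_power_nth: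
  "((1 - expm1_quot) ^ r :: 'a :: field_char_0 fps) $ l =
     fact r / fact (l + r) *
     (\<Sum>i = 0..r. (-1) ^ i * of_nat ((l + r) choose (r - i)) * of_nat (Stirling (l + i) i))"
proof -
  \<comment> \<open>Both sides are \<open>r!/((r-i)! (l+i)!)\<close>; the right-hand form isolates a
    factor free of i.\<close>
  have "of_nat (r choose i) * (fact i / fact (l + i)) =
      (fact r / fact (l + r) * of_nat ((l + r) choose (r - i)) :: 'a)" if "i \<le> r" for i
    using that by (simp add: binomial_fact)
  then show ?thesis
    unfolding one_minus_expm1_quot_power fps_sum_nth sum_distrib_left
    by (intro sum.cong refl) (simp add: expm1_quot_power_nth field_simps)
qed

section \<open>From the analytic generating function to a formal reciprocal\<close>

lemma bernoulli_poly_fps: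
  "Abs_fps (\<lambda>k. bernoulli_poly k u / fact k) * (fps_exp 1 - 1) = fps_X * fps_exp u"
proof -
  define F where "F = Abs_fps (\<lambda>k. bernoulli_poly k u / fact k)"
  have sums: "(\<lambda>k. F $ k * z ^ k) sums (z * exp (u * z) / (exp z - 1))"
    if "z \<noteq> 0" "norm z < 2 * pi" for z
    using bernoulli_poly_sums[OF that, of u] by (simp add: F_def)
  \<comment> \<open>Convergence at the single point 1, which lies inside the disc, already gives a
    positive radius.\<close>
  have "fps_conv_radius F \<ge> ereal 1"
    unfolding fps_conv_radius_def
    using conv_radius_geI[OF sums_summable[OF sums[of 1]]] pi_gt3 by simp
  then have rad: "fps_conv_radius F > 0"
    by (rule less_le_trans[rotated]) simp
  have "eventually (\<lambda>z. eval_fps F z * (exp z - 1) = z * exp (u * z)) (nhds 0)"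
  proof (rule eventually_nhds_in_open[of "ball 0 (2 * pi)", THEN eventually_mono])
    fix z :: complex assume "z \<in> ball 0 (2 * pi)"
    \<comment> \<open>The exponential takes no value twice at points whose imaginary parts differ by
      less than \<open>2 * pi\<close>.\<close>
    moreover have "exp z \<noteq> 1" if "z \<noteq> 0" "norm z < 2 * pi"
      using that exp_complex_eqI[of z 0] abs_Im_le_cmod[of z] by auto
    \<comment> \<open>At the origin, which the defining sums leave out, both sides are 0.\<close>
    ultimately show "eval_fps F z * (exp z - 1) = z * exp (u * z)"
      by (cases "z = 0") (auto simp: eval_fps_def simp flip: sums_unique[OF sums])
  qed auto
  moreover have "eval_fps F has_fps_expansion F"
    using rad by (simp add: has_fps_expansion_def)
  then have "(\<lambda>z. eval_fps F z * (exp z - 1)) has_fps_expansion F * (fps_exp 1 - 1)"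
    by (intro fps_expansion_intros)
  moreover have "(\<lambda>z. z * exp (u * z)) has_fps_expansion fps_X * fps_exp u"
    by (intro fps_expansion_intros)
  ultimately show ?thesis
    unfolding F_def[symmetric] by (metis fps_expansion_unique_complex has_fps_expansion_cong)
qed

text \<open>Truncated geometric series for \<open>F = 1/G\<close>: since \<open>1 - G\<close> has no
  constant term, its power \<open>Suc n\<close> contributes nothing up to degree n.\<close>

lemma fps_nth_eq_sum_one_minus_powers:
  fixes F G :: "'a :: comm_ring_1 fps"
  assumes "F * G = 1" "G $ 0 = 1"
  shows "F $ n = (\<Sum>k=0..n. (1 - G) ^ k $ n)"
proof -
  have "(\<Sum>k\<le>n. (1 - G) ^ k) * G = 1 - (1 - G) ^ Suc n"
    using one_diff_power_eq'[of "1 - G" "Suc n"] sum_gp_basic[of "1 - G" n] by (simp add: mult.commute)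
  then have "(\<Sum>k\<le>n. (1 - G) ^ k) * (F * G) = F - F * (1 - G) ^ Suc n"
    by (metis (no_types, lifting) mult.assoc mult.commute mult.right_neutral right_diff_distrib)
  then have "(\<Sum>k\<le>n. (1 - G) ^ k) = F - F * (1 - G) ^ Suc n"
    using assms(1) by simp
  moreover have "(F * (1 - G) ^ Suc n) $ n = 0"
  proof -
    have "(1 - G) ^ Suc n $ j = 0" if "j \<le> n" for j
      using startsby_zero_power_prefix[of "1 - G" "Suc n"] assms(2) that by (simp add: less_Suc_eq_le del: power_Suc)
    then show ?thesis by (simp add: fps_mult_nth del: power_Suc)
  qed
  ultimately show ?thesis
    by (metis (no_types, lifting) atLeast0AtMost diff_zero fps_sub_nth fps_sum_nth sum.cong)
qed

text \<open>In the notation of the introduction, $1 - G$ is \<open>scaled_defect (1 - u) - scaled_defect (- u)\<close>.\<close>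

definition scaled_defect :: "'a :: field_char_0 \<Rightarrow> 'a fps" where
  "scaled_defect c = fps_const c * ((1 - expm1_quot) oo (fps_const c * fps_X))"

text \<open>Since \<open>c E(cz) = (e^(cz) - 1)/z\<close>, clearing the denominator leaves only
  exponentials to compare with the generating function.\<close>

lemma X_mult_scaled_defect: "fps_X * scaled_defect c = fps_const c * fps_X - fps_exp c + 1"
proof (rule fps_ext)
  fix n show "(fps_X * scaled_defect c) $ n = (fps_const c * fps_X - fps_exp c + 1) $ n"
    by (cases n) (auto simp: scaled_defect_def expm1_quot_def)
qed

text \<open>The prefactor yields \<open>c^r\<close> and the substitution \<open>c^l\<close>; hence
  the exponents \<open>l + r\<close> and \<open>m + s\<close> in the final formula.\<close>

lemma scaled_defect_power_nth:
  "scaled_defect c ^ r $ l = c ^ (l + r) * ((1 - expm1_quot) ^ r $ l)"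
  by (simp add: scaled_defect_def power_mult_distrib fps_compose_power power_add)

lemma bernoulli_poly_eq_sum_powers:
  "bernoulli_poly n u = fact n * (\<Sum>k=0..n. (scaled_defect (1 - u) - scaled_defect (- u)) ^ k $ n)"
proof -
  define F where "F = Abs_fps (\<lambda>k. bernoulli_poly k u / fact k)"
  define H where "H = scaled_defect (1 - u) - scaled_defect (- u)"
  \<comment> \<open>The goal \<open>F * (1 - H) = 1\<close> is multiplied by the nonzero series
    \<open>z e^(uz)\<close>, which is cancelled at the end.\<close>
  have "fps_X * fps_exp u * (F * (1 - H)) = F * (fps_exp u * (fps_X * (1 - H)))"
    by (simp only: mult_ac)
  also have "fps_X * (1 - H) = fps_exp (1 - u) - fps_exp (- u)"
    unfolding H_def right_diff_distrib X_mult_scaled_defect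
    by (simp add: algebra_simps flip: fps_const_sub fps_const_neg)
  also have "fps_exp u * \<dots> = fps_exp 1 - 1"
    by (simp add: right_diff_distrib flip: fps_exp_add_mult)
  also have "F * (fps_exp 1 - 1) = fps_X * fps_exp u"
    using bernoulli_poly_fps[of u] by (simp add: F_def)
  finally have "F * (1 - H) = 1"
    by simp
  moreover have "(1 - H) $ 0 = 1"
    by (simp add: H_def scaled_defect_def expm1_quot_def)
  ultimately have "F $ n = (\<Sum>k=0..n. H ^ k $ n)"
    using fps_nth_eq_sum_one_minus_powers[of F "1 - H" n] by simp
  then show ?thesis by (simp add: F_def H_def field_simps)
qed

section \<open>Binomial expansion for arbitrary u\<close>

lemma fps_binomial_nth:
  fixes a b :: "'a :: field_char_0 fps"
  shows "(a + b) ^ k $ n =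
    fact k * (\<Sum>(r, s) \<in> {(r, s). r + s = k}. \<Sum>(l, m) \<in> {(l, m). l + m = n}.
      (a ^ r $ l / fact r) * (b ^ s $ m / fact s))"
proof -
  have anti: "{(i, j). i + j = N} = (\<lambda>i. (i, N - i)) ` {..N}" for N :: nat
    by force
  have "(a + b) ^ k $ n = (\<Sum>r\<le>k. \<Sum>l\<le>n. of_nat (k choose r) * (a ^ r $ l * b ^ (k - r) $ (n - l)))"
    by (simp add: binomial_ring fps_sum_nth mult.assoc fps_mult_nth[of "a ^ _"] atLeast0AtMost
        sum_distrib_left flip: fps_of_nat)
  also have "\<dots> = (\<Sum>r\<le>k. \<Sum>l\<le>n. fact k * ((a ^ r $ l / fact r) * (b ^ (k - r) $ (n - l) / fact (k - r))))"
    by (intro sum.cong refl) (simp add: binomial_fact)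
  finally show ?thesis
    by (simp add: anti sum.reindex inj_on_def sum_distrib_left)
qed

lemma scaled_defect_power_product:
  fixes u :: complex
  assumes "l + m = n"
  shows "fact n * ((scaled_defect (1 - u) ^ r $ l / fact r) * ((- scaled_defect (- u)) ^ s $ m / fact s)) =
    (-1) ^ m * of_nat (n choose l) * (fact l / fact (l + r)) * (fact m / fact (m + s)) *
      (\<Sum>i = 0..r. \<Sum>j = 0..s.
         (-1) ^ (i + j) * of_nat ((l + r) choose (r - i)) * of_nat ((m + s) choose (s - j)) *
         of_nat (Stirling (l + i) i) * of_nat (Stirling (m + j) j)) *
      u ^ (m + s) * (1 - u) ^ (l + r)"
proof -
  define A where "A = (\<lambda>r l. \<Sum>i = 0..r. (-1) ^ i * of_nat ((l + r) choose (r - i)) *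
      of_nat (Stirling (l + i) i) :: complex)"
  have D: "(1 - expm1_quot :: complex fps) ^ r $ l = fact r / fact (l + r) * A r l" for r l
    by (simp add: A_def one_minus_expm1_quot_power_nth)
  have AA: "(\<Sum>i = 0..r. \<Sum>j = 0..s.
                (-1) ^ (i + j) * of_nat ((l + r) choose (r - i)) * of_nat ((m + s) choose (s - j)) *
                of_nat (Stirling (l + i) i) * of_nat (Stirling (m + j) j)) = A r l * A s m"
    unfolding A_def sum_product by (intro sum.cong refl) (simp add: power_add mult_ac)
  have "(- scaled_defect (- u)) ^ s $ m = (-1) ^ s * (scaled_defect (- u) ^ s $ m)"
    by (cases "even s") simp_all
  \<comment> \<open>The sign \<open>(-1)^s\<close> meets \<open>(-1)^(m+s)\<close> from
    \<open>(-u)^(m+s)\<close>, leaving \<open>(-1)^m\<close>.\<close>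
  also have "\<dots> = (-1) ^ m * u ^ (m + s) * ((1 - expm1_quot :: complex fps) ^ s $ m)"
    by (cases "even s"; cases "even m") (simp_all add: scaled_defect_power_nth)
  finally have "fact n * ((scaled_defect (1 - u) ^ r $ l / fact r) *
        ((- scaled_defect (- u)) ^ s $ m / fact s))
      = fact n * (((1 - u) ^ (l + r) * (A r l / fact (l + r))) *
        ((-1) ^ m * u ^ (m + s) * (A s m / fact (m + s))))"
    by (simp add: scaled_defect_power_nth D)
  moreover have "fact n = (of_nat (n choose l) * fact l * fact m :: complex)"
    using assms by (auto simp: binomial_fact)
  ultimately show ?thesis
    unfolding AA by (simp add: mult_ac)
qed

lemma bernoulli_poly_Stirling:
  assumes "n \<ge> 1"
  shows "bernoulli_poly n u = (\<Sum>k = 1..n. fact k *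
    (\<Sum>(r, s) \<in> {(r, s). r + s = k}. \<Sum>(l, m) \<in> {(l, m). l + m = n}.
      (-1) ^ m * of_nat (n choose l) * (fact l / fact (l + r)) * (fact m / fact (m + s)) *
      (\<Sum>i = 0..r. \<Sum>j = 0..s.
         (-1) ^ (i + j) * of_nat ((l + r) choose (r - i)) * of_nat ((m + s) choose (s - j)) *
         of_nat (Stirling (l + i) i) * of_nat (Stirling (m + j) j)) *
      u ^ (m + s) * (1 - u) ^ (l + r)))"
proof -
  \<comment> \<open>The term \<open>k = 0\<close> drops out: the series 1 has no coefficient in
    degree \<open>n \<ge> 1\<close>.\<close>
  have "bernoulli_poly n u =
      fact n * (\<Sum>k = 1..n. (scaled_defect (1 - u) + - scaled_defect (- u)) ^ k $ n)"
    using assms by (simp add: bernoulli_poly_eq_sum_powers sum.atLeast_Suc_atMost)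
  also have "\<dots> = (\<Sum>k = 1..n. fact k *
      (\<Sum>(r, s) \<in> {(r, s). r + s = k}. \<Sum>(l, m) \<in> {(l, m). l + m = n}.
        fact n * ((scaled_defect (1 - u) ^ r $ l / fact r) * ((- scaled_defect (- u)) ^ s $ m / fact s))))"
    unfolding fps_binomial_nth by (simp add: sum_distrib_left case_prod_unfold mult_ac)
  also have "\<dots> = (\<Sum>k = 1..n. fact k *
      (\<Sum>(r, s) \<in> {(r, s). r + s = k}. \<Sum>(l, m) \<in> {(l, m). l + m = n}.
      (-1) ^ m * of_nat (n choose l) * (fact l / fact (l + r)) * (fact m / fact (m + s)) *
      (\<Sum>i = 0..r. \<Sum>j = 0..s.
         (-1) ^ (i + j) * of_nat ((l + r) choose (r - i)) * of_nat ((m + s) choose (s - j)) *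
         of_nat (Stirling (l + i) i) * of_nat (Stirling (m + j) j)) *
      u ^ (m + s) * (1 - u) ^ (l + r)))"
    unfolding case_prod_unfold
    by (intro sum.cong refl arg_cong[where f = "(*) (fact _)"] scaled_defect_power_product) auto
  finally show ?thesis .
qed

section \<open>The Bernoulli numbers: the case u = 0\<close>

lemma bernoulli_number_Stirling:
  assumes "n \<ge> 1"
  shows "bernoulli_number n = (\<Sum>i = 1..n. (-1) ^ i *
    (of_nat ((n + 1) choose (i + 1)) / of_nat ((n + i) choose i)) * of_nat (Stirling (n + i) i))"
proof -
  \<comment> \<open>For u = 0 the two defects are \<open>1 - E\<close> and 0.\<close>
  have "bernoulli_number n = fact n * (\<Sum>k=0..n. (1 - expm1_quot :: complex fps) ^ k $ n)"
    by (simp add: bernoulli_number_def bernoulli_poly_eq_sum_powers scaled_defect_def fps_compose_linear)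
  \<comment> \<open>Extending i up to n adds only vanishing binomials and makes the range
    independent of k, so that the sums can be swapped.\<close>
  also have "(\<Sum>k=0..n. (1 - expm1_quot :: complex fps) ^ k $ n) =
      (\<Sum>k=0..n. \<Sum>i=0..n. (-1) ^ i * of_nat (k choose i) * ((expm1_quot :: complex fps) ^ i $ n))"
  proof (intro sum.cong refl)
    fix k assume "k \<in> {0..n}"
    then show "(1 - expm1_quot :: complex fps) ^ k $ n =
        (\<Sum>i=0..n. (-1) ^ i * of_nat (k choose i) * ((expm1_quot :: complex fps) ^ i $ n))"
      unfolding one_minus_expm1_quot_power sum_distrib_left
      by (auto simp: fps_sum_nth intro!: sum.mono_neutral_cong_left)
  qed
  also have "\<dots> = (\<Sum>i=0..n. (-1) ^ i * of_nat (\<Sum>k\<le>n. k choose i) * ((expm1_quot :: complex fps) ^ i $ n))"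
    by (subst sum.swap) (simp add: sum_distrib_left sum_distrib_right atLeast0AtMost)
  \<comment> \<open>Hockey-stick identity; the term \<open>i = 0\<close> vanishes because
    \<open>E^0 = 1\<close> and \<open>n \<ge> 1\<close>.\<close>
  also have "\<dots> = (\<Sum>i=1..n. (-1) ^ i * of_nat (Suc n choose Suc i) * ((expm1_quot :: complex fps) ^ i $ n))"
    unfolding sum_choose_upper using assms by (subst sum.atLeast_Suc_atMost) simp_all
  \<comment> \<open>The factor \<open>n! i!/(n+i)!\<close> is the reciprocal of the binomial
    coefficient in the denominator.\<close>
  also have "fact n * \<dots> = (\<Sum>i = 1..n. (-1) ^ i *
            (of_nat ((n + 1) choose (i + 1)) / of_nat ((n + i) choose i)) *
            of_nat (Stirling (n + i) i))"
    unfolding sum_distrib_left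
    by (intro sum.cong refl) (simp add: expm1_quot_power_nth binomial_fact)
  finally show ?thesis .
qed

theorem theorem1p1:
  fixes n :: nat
  assumes "n \<ge> 1"
  shows "(\<forall>u :: complex. bernoulli_poly n u =
           (\<Sum>k = 1..n. fact k *
             (\<Sum>(r, s) \<in> {(r, s). r + s = k}.
               \<Sum>(l, m) \<in> {(l, m). l + m = n}.
                 (-1) ^ m * of_nat (n choose l) * (fact l / fact (l + r)) * (fact m / fact (m + s)) *
                 (\<Sum>i = 0..r. \<Sum>j = 0..s.
                    (-1) ^ (i + j) * of_nat ((l + r) choose (r - i)) * of_nat ((m + s) choose (s - j)) *
                    of_nat (Stirling (l + i) i) * of_nat (Stirling (m + j) j)) *
                 u ^ (m + s) * (1 - u) ^ (l + r))))
    \<and> bernoulli_number n =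
           (\<Sum>i = 1..n. (-1) ^ i *
              (of_nat ((n + 1) choose (i + 1)) / of_nat ((n + i) choose i)) *
              of_nat (Stirling (n + i) i))"
  using assms bernoulli_poly_Stirling bernoulli_number_Stirling by blast

end
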